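(* Let $n,p$ be positive integers with $p \ge n$, let $X\in\mathbb{R}^{n\times p}$ have columns normalized so that $\|X_j\|_2=\sqrt n$ for all $1\le j\le p$, and let $y = X\beta_\star+z$ with $z\sim\mathcal{N}(0,\sigma^2 I_n)$, where $\beta_\star$ has support $J_\star$ of size $s_\star$ with $1\le s_\star\le\overline{s}$. Assume that the sparsity parameter of the prior is $\lambda = (62+12c)\log p$ for some $c>0$. Then with probability at least $1-p^{-c}$, $$\|X\widehat\beta_{\rm map}-X\beta_\star\|_2\le \sigma\sqrt{8 s_\star\lambda}\quad\text{and}\quad \|X\widehat\beta_{\rm mean}-X\beta_\star\|_2\le\sigma\sqrt{12 s_\star\lambda}.$$
   Context: Model: $y=X\beta_\star+z\in\mathbb{R}^n$ with $X\in\mathbb{R}^{n\times p}$ deterministic, $z\sim\mathcal{N}(0,\sigma^2 I_n)$ and $\sigma>0$ known. The vector $\beta_\star\in\mathbb{R}^p$ is one of the vectors $\beta$ of minimal support size among those satisfying $X\beta=\mathbb{E}(y)$; $J_\star\subset[p]:=\{1,\dots,p\}$ is its support and $s_\star=|J_\star|$. $\|\cdot\|_2$ is the Euclidean norm. For $J\subset[p]$, $X_J$ is the submatrix of $X$ with columns $X_j$, $j\in J$; $P_J$ is the orthogonal projection of $\mathbb{R}^n$ onto the span of $\{X_j: j\in J\}$, and $P_J^\perp=I_n-P_J$. Prior and pseudo-posterior: fix an integer upper bound $\overline{s}\le p$ on the support size (with $s_\star\le\overline{s}$) and a parameter $\lambda>0$. The prior on subsets $J\subset[p]$ is the probability distribution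 $\pi(J)\propto\binom{p}{|J|}^{-1}e^{-\lambda|J|}\mathbf{1}_{\{|J|\le\overline{s}\}}$, and the pseudo-posterior is the probability distribution $\Pi(J)\propto\pi(J)\exp\left(-\frac{\|P_J^\perp y\|_2^2}{2\sigma^2}\right)$. Estimators: for $J\subset[p]$, $\widehat\beta_J$ is the minimum-Euclidean-norm least squares coefficient vector for regressing $y$ on $X_J$, viewed as a vector of $\mathbb{R}^p$ by setting coordinates outside $J$ to $0$ (so $X\widehat\beta_J=P_Jy$). $\widehat J_{\rm map}\in\arg\max_J\Pi(J)$, $\widehat\beta_{\rm map}=\widehat\beta_{\widehat J_{\rm map}}$, and $\widehat\beta_{\rm mean}=\sum_{J\subset[p]}\Pi(J)\widehat\beta_J$. *)

theory Defs
  imports "HOL-Probability.Probability"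
begin

definition support :: "real ^ 'p::finite \<Rightarrow> 'p set" where
  "support \<beta> = {j. \<beta> $ j \<noteq> 0}"

definition col_span :: "real ^ 'p::finite ^ 'n::finite \<Rightarrow> 'p set \<Rightarrow> (real ^ 'n) set" where
  "col_span X J = span ((\<lambda>j. column j X) ` J)"

definition proj :: "real ^ 'p::finite ^ 'n::finite \<Rightarrow> 'p set \<Rightarrow> real ^ 'n \<Rightarrow> real ^ 'n" where
  "proj X J y = (THE u. u \<in> col_span X J \<and> (\<forall>w\<in>col_span X J. orthogonal (y - u) w))"

text \<open>The density of $N(0, \sigma^2 I_n)$; note that \<open>normal_density\<close> takes the standard
  deviation, not the variance.\<close>

definition iso_normal_density :: "real \<Rightarrow> real ^ 'n::finite \<Rightarrow> real" where
  "iso_normal_density \<sigma> x = (\<Prod>i\<in>UNIV. normal_density 0 \<sigma> (x $ i))"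

definition normalized :: "('a::finite \<Rightarrow> real) \<Rightarrow> 'a \<Rightarrow> real" where
  "normalized w a = w a / (\<Sum>b\<in>UNIV. w b)"

definition prior :: "nat \<Rightarrow> real \<Rightarrow> 'p::finite set \<Rightarrow> real" where
  "prior smax lam = normalized (\<lambda>J.
     if card J \<le> smax
     then inverse (real (CARD('p) choose card J)) * exp (- lam * real (card J))
     else 0)"

definition posterior ::
    "real ^ 'p::finite ^ 'n::finite \<Rightarrow> real \<Rightarrow> nat \<Rightarrow> real \<Rightarrow> real ^ 'n \<Rightarrow> 'p set \<Rightarrow> real" where
  "posterior X \<sigma> smax lam y = normalized (\<lambda>J.
     prior smax lam J * exp (- ((norm (y - proj X J y))\<^sup>2) / (2 * \<sigma>\<^sup>2)))"

text \<open>Coefficient vectors of regressions on \<open>X\<^sub>J\<close> are represented by vectors indexed by all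
  columns whose support lies in \<open>J\<close>.\<close>

definition least_squares ::
    "real ^ 'p::finite ^ 'n::finite \<Rightarrow> real ^ 'n \<Rightarrow> 'p set \<Rightarrow> (real ^ 'p) set" where
  "least_squares X y J =
     {\<beta>. is_arg_min (\<lambda>b. norm (y - X *v b)) (\<lambda>b. support b \<subseteq> J) \<beta>}"

definition beta_hat ::
    "real ^ 'p::finite ^ 'n::finite \<Rightarrow> real ^ 'n \<Rightarrow> 'p set \<Rightarrow> real ^ 'p" where
  "beta_hat X y J = (THE \<beta>. is_arg_min norm (\<lambda>b. b \<in> least_squares X y J) \<beta>)"

text \<open>The set of all maximizers, since the maximizer of the posterior need not be unique.\<close>

definition map_models ::
    "real ^ 'p::finite ^ 'n::finite \<Rightarrow> real \<Rightarrow> nat \<Rightarrow> real \<Rightarrow> real ^ 'n \<Rightarrow> 'p set set" where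
  "map_models X \<sigma> smax lam y = {J. is_arg_max (posterior X \<sigma> smax lam y) (\<lambda>_. True) J}"

definition beta_mean ::
    "real ^ 'p::finite ^ 'n::finite \<Rightarrow> real \<Rightarrow> nat \<Rightarrow> real \<Rightarrow> real ^ 'n \<Rightarrow> real ^ 'p" where
  "beta_mean X \<sigma> smax lam y =
     (\<Sum>J\<in>UNIV. posterior X \<sigma> smax lam y J *\<^sub>R beta_hat X y J)"

end

theory Submission imports Defs begin

text \<open>Write \<open>m = X *v \<beta>star\<close>, \<open>S\<close> for its support, \<open>s = card S\<close>, \<open>k = card J\<close> and \<open>L = ln p\<close>.
  A Chernoff bound and a union bound over all sets \<open>K\<close> of columns show that
  \<open>(norm (P\<^sub>K z))\<^sup>2 \<le> (10 + 4 * c) * L * card K * \<sigma>\<^sup>2\<close> holds simultaneously for all \<open>K\<close> with the required probability.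
  On this event the residual sum of squares of \<open>J\<close> exceeds that of \<open>S\<close> by at least half the squared risk
  \<open>(norm (P\<^sub>J y - m))\<^sup>2\<close> minus twice the noise on \<open>J \<union> S\<close>. The penalty \<open>lam\<close> dominates that noise as well as
  the binomial coefficients in the prior, so the posterior ratio of \<open>J\<close> to \<open>S\<close> is at most
  \<open>exp (2 * s * lam - r * s - r * k - (norm (P\<^sub>J y - m))\<^sup>2 / (4 * \<sigma>\<^sup>2))\<close> with \<open>r = 51 * L\<close>.
  A maximizer has ratio at least 1, which bounds its squared risk by \<open>8 * s * lam * \<sigma>\<^sup>2\<close>. For the mean, Jensen's
  inequality reduces the claim to the posterior average of the excess of the squared risk over this level,
  which the factors \<open>exp (- r * k)\<close> keep below \<open>4 * \<sigma>\<^sup>2\<close>.\<close>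

subsection \<open>Projections and least squares\<close>

lemma subspace_col_span: "subspace (col_span X J)"
  by (simp add: col_span_def)

lemma col_span_mono: "J \<subseteq> K \<Longrightarrow> col_span X J \<subseteq> col_span X K"
  unfolding col_span_def by (intro span_mono image_mono)

lemma dim_col_span_le: "dim (col_span X J) \<le> card J"
proof -
  have "dim ((\<lambda>j. column j X) ` J) \<le> card ((\<lambda>j. column j X) ` J)"
    by (intro dim_le_card span_superset) simp
  also have "\<dots> \<le> card J" by (intro card_image_le) simp
  finally show ?thesis by (simp add: col_span_def)
qed

text \<open>Two candidates differ by a vector of the span that is orthogonal to itself. This makes
  the definite description in \<open>proj\<close> usable.\<close>

lemma proj_unique:
  assumes "u \<in> col_span X J" "\<And>w. w \<in> col_span X J \<Longrightarrow> orthogonal (y - u) w"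
  shows "proj X J y = u"
  unfolding proj_def
proof (rule the_equality)
  fix v assume v: "v \<in> col_span X J \<and> (\<forall>w\<in>col_span X J. orthogonal (y - v) w)"
  have "v - u \<in> col_span X J"
    using assms v subspace_col_span subspace_diff by blast
  then have "orthogonal (y - u) (v - u)" "orthogonal (y - v) (v - u)"
    using assms v by auto
  then have "(v - u) \<bullet> (v - u) = 0"
    unfolding orthogonal_def by (simp add: inner_diff_left inner_diff_right)
  then show "v = u" by simp
qed (use assms in auto)

lemma proj_exists:
  "proj X J y \<in> col_span X J \<and> (\<forall>w\<in>col_span X J. orthogonal (y - proj X J y) w)"
proof -
  obtain u v where "u \<in> col_span X J" "\<And>w. w \<in> col_span X J \<Longrightarrow> orthogonal v w" "y = u + v"
    using orthogonal_subspace_decomp_exists[of "(\<lambda>j. column j X) ` J" y] unfolding col_span_def by metis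
  then show ?thesis using proj_unique[of u X J y] by auto
qed

lemma proj_in: "proj X J y \<in> col_span X J"
  using proj_exists by blast

lemma proj_orthogonal: "w \<in> col_span X J \<Longrightarrow> (y - proj X J y) \<bullet> w = 0"
  using proj_exists unfolding orthogonal_def by blast

lemma proj_id: "y \<in> col_span X J \<Longrightarrow> proj X J y = y"
  by (rule proj_unique) (auto simp: orthogonal_def)

lemma linear_proj: "linear (proj X J)"
proof (rule linearI)
  show "proj X J (a + b) = proj X J a + proj X J b" for a b
  proof (rule proj_unique)
    show "proj X J a + proj X J b \<in> col_span X J"
      by (intro subspace_add[OF subspace_col_span] proj_in)
    show "orthogonal (a + b - (proj X J a + proj X J b)) w" if "w \<in> col_span X J" for w
      using proj_orthogonal[OF that, of a] proj_orthogonal[OF that, of b]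
      by (simp add: orthogonal_def add_diff_add inner_add_left)
  qed
  show "proj X J (r *\<^sub>R a) = r *\<^sub>R proj X J a" for r a
  proof (rule proj_unique)
    show "r *\<^sub>R proj X J a \<in> col_span X J"
      by (intro subspace_scale[OF subspace_col_span] proj_in)
    show "orthogonal (r *\<^sub>R a - r *\<^sub>R proj X J a) w" if "w \<in> col_span X J" for w
      using proj_orthogonal[OF that, of a]
      by (simp add: orthogonal_def flip: scaleR_diff_right)
  qed
qed

lemma proj_measurable [measurable]: "proj X J \<in> borel_measurable borel"
  by (intro borel_measurable_continuous_onI linear_continuous_on linear_proj
        linear_proj[THEN linear_conv_bounded_linear[THEN iffD1]])

lemma norm_sq_split:
  assumes "w \<in> col_span X J"
  shows "(norm (y - w))\<^sup>2 = (norm (y - proj X J y))\<^sup>2 + (norm (proj X J y - w))\<^sup>2"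
proof -
  have "orthogonal (y - proj X J y) (proj X J y - w)"
    using proj_orthogonal assms proj_in subspace_col_span subspace_diff unfolding orthogonal_def by blast
  from norm_add_Pythagorean[OF this] show ?thesis by simp
qed

lemma support_subset_iff: "support b \<subseteq> J \<longleftrightarrow> (\<forall>j. j \<notin> J \<longrightarrow> b $ j = 0)"
  by (auto simp: support_def)

lemma mult_in_col_span:
  assumes "support b \<subseteq> J" shows "X *v b \<in> col_span X J"
proof -
  have "X *v b = (\<Sum>j\<in>UNIV. b $ j *\<^sub>R column j X)"
    by (simp add: matrix_mult_sum scalar_mult_eq_scaleR)
  also have "\<dots> \<in> col_span X J"
  proof (rule subspace_sum[OF subspace_col_span])
    fix j
    show "b $ j *\<^sub>R column j X \<in> col_span X J"
    proof (cases "b $ j = 0")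
      case True
      then show ?thesis using subspace_0[OF subspace_col_span] by simp
    next
      case False
      then have "j \<in> J" using assms by (auto simp: support_def)
      then show ?thesis unfolding col_span_def by (intro span_scale span_base) auto
    qed
  qed
  finally show ?thesis .
qed

lemma col_span_image:
  fixes X :: "real ^ 'p::finite ^ 'n::finite"
  assumes "w \<in> col_span X J"
  obtains b where "support b \<subseteq> J" "X *v b = w"
proof -
  have "subspace {w. \<exists>b. support b \<subseteq> J \<and> X *v b = w}"
  proof -
    have "{w. \<exists>b. support b \<subseteq> J \<and> X *v b = w} = (\<lambda>b. X *v b) ` {b. support b \<subseteq> J}" by auto
    moreover have "subspace {b :: real ^ 'p. support b \<subseteq> J}"
      by (simp add: subspace_def support_subset_iff)
    ultimately show ?thesis
      using linear_subspace_image[OF matrix_vector_mul_linear] by metis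
  qed
  moreover have "(\<lambda>j. column j X) ` J \<subseteq> {w. \<exists>b. support b \<subseteq> J \<and> X *v b = w}"
  proof clarify
    fix j assume "j \<in> J"
    then show "\<exists>b. support b \<subseteq> J \<and> X *v b = column j X"
      by (intro exI[of _ "axis j 1"]) (simp add: support_subset_iff axis_def matrix_vector_mult_basis[unfolded axis_def])
  qed
  ultimately have "col_span X J \<subseteq> {w. \<exists>b. support b \<subseteq> J \<and> X *v b = w}"
    unfolding col_span_def by (rule span_minimal[rotated])
  with assms that show ?thesis by blast
qed

text \<open>By Pythagoras, the squared error of \<open>b\<close> is that of the projection plus the
  squared distance of \<open>X *v b\<close> from the projection, and that distance can be made
  zero.\<close>

lemma least_squares_eq:
  "least_squares X y J = {b. support b \<subseteq> J \<and> X *v b = proj X J y}" (is "_ = ?S")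
proof -
  obtain b0 where b0: "support b0 \<subseteq> J" "X *v b0 = proj X J y"
    using col_span_image[OF proj_in] by metis
  have sq: "(norm (y - X *v b))\<^sup>2 = (norm (y - proj X J y))\<^sup>2 + (norm (proj X J y - X *v b))\<^sup>2"
    if "support b \<subseteq> J" for b
    using norm_sq_split[OF mult_in_col_span[OF that]] .
  show ?thesis
  proof (intro equalityI subsetI)
    fix b assume "b \<in> least_squares X y J"
    then have b: "support b \<subseteq> J" and "\<not> norm (y - X *v b0) < norm (y - X *v b)"
      using b0 by (auto simp: least_squares_def is_arg_min_def)
    then have "(norm (y - X *v b))\<^sup>2 \<le> (norm (y - X *v b0))\<^sup>2"
      by (intro power_mono) auto
    then show "b \<in> ?S" using sq[OF b] b0 b by simp
  next
    fix b assume b: "b \<in> ?S"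
    have "norm (y - X *v b) \<le> norm (y - X *v b')" if "support b' \<subseteq> J" for b'
      by (rule power2_le_imp_le) (use sq[OF that] b in auto)
    then show "b \<in> least_squares X y J"
      using b by (auto simp: least_squares_def is_arg_min_def not_less)
  qed
qed

text \<open>The definite description in \<open>beta_hat\<close> is meaningful because a nonempty
  closed convex set has exactly one point nearest to 0.\<close>

lemma beta_hat_in:
  fixes X :: "real ^ 'p::finite ^ 'n::finite"
  shows "beta_hat X y J \<in> least_squares X y J"
proof -
  let ?S = "least_squares X y J"
  have "convex ?S"
    unfolding least_squares_eq
    by (simp add: convex_def support_subset_iff matrix_vector_right_distrib matrix_vector_mult_scaleR
        flip: scaleR_add_left)
  moreover have "closed ?S"
  proof -
    have "?S = {b. X *v b = proj X J y} \<inter> (\<Inter>j\<in>-J. {b. b $ j = 0})"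
      unfolding least_squares_eq support_def by auto
    moreover have "closed {b. X *v b = proj X J y}"
      by (intro closed_Collect_eq continuous_intros)
    moreover have "closed {b::real^'p. b $ j = 0}" for j
      by (intro closed_Collect_eq continuous_intros)
    ultimately show ?thesis by (simp only:) (intro closed_Int closed_INT ballI)
  qed
  moreover have "?S \<noteq> {}"
    unfolding least_squares_eq using col_span_image[OF proj_in] by blast
  ultimately obtain b where b: "b \<in> ?S" "\<And>b'. b' \<in> ?S \<Longrightarrow> dist 0 b \<le> dist 0 b'"
    using distance_attains_inf[of ?S 0] by metis
  have "beta_hat X y J = b"
    unfolding beta_hat_def
  proof (rule the_equality)
    show "is_arg_min norm (\<lambda>b. b \<in> ?S) b" using b by (auto simp: is_arg_min_def not_less)
    show "b' = b" if "is_arg_min norm (\<lambda>b. b \<in> ?S) b'" for b'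
      by (rule any_closest_point_unique[OF \<open>convex ?S\<close> \<open>closed ?S\<close>, of _ _ 0])
         (use that b in \<open>auto simp: is_arg_min_def not_less\<close>)
  qed
  with b show ?thesis by simp
qed

lemma mult_beta_hat: "X *v beta_hat X y J = proj X J y"
  using beta_hat_in unfolding least_squares_eq by blast

text \<open>The error of the fit splits into a bias \<open>a\<close>, orthogonal to the span of
  \<open>J\<close>, and the projected noise \<open>P\<close>. As \<open>a\<close> lies in the span
  of \<open>J \<union> S\<close>, its cross term with the noise involves only \<open>V\<close>, and
  completing the square absorbs it.\<close>

lemma risk_decomposition:
  fixes X :: "real ^ 'p::finite ^ 'n::finite"
  assumes y: "y = m + z" and m: "m \<in> col_span X S"
  shows "(norm (y - proj X J y))\<^sup>2 - (norm (y - proj X S y))\<^sup>2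
     \<ge> (norm (proj X J y - m))\<^sup>2 / 2 - 2 * (norm (proj X (J \<union> S) z))\<^sup>2"
proof -
  define a where "a = m - proj X J m"
  define P where "P = proj X J z"
  define V where "V = proj X (J \<union> S) z"
  have yJ: "proj X J y = proj X J m + P"
    by (simp add: y P_def linear_add[OF linear_proj])
  have yS: "proj X S y = m + proj X S z"
    by (simp add: y linear_add[OF linear_proj] proj_id[OF m])
  have inJ: "proj X J w \<in> col_span X (J \<union> S)" for w
    using proj_in col_span_mono[of J "J \<union> S"] by blast
  have aV: "a \<in> col_span X (J \<union> S)"
    unfolding a_def using inJ m col_span_mono[of S "J \<union> S"] subspace_diff[OF subspace_col_span] by blast
  have aP: "a \<bullet> P = 0" unfolding a_def P_def by (rule proj_orthogonal[OF proj_in])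
  have za: "z \<bullet> a = V \<bullet> a" using proj_orthogonal[OF aV, of z] by (simp add: V_def inner_diff_left)
  have zP: "z \<bullet> P = P \<bullet> P"
    using proj_orthogonal[OF proj_in, of z X J z] by (simp add: P_def inner_diff_left)
  have VP: "V \<bullet> P = P \<bullet> P"
    using proj_orthogonal[OF inJ, of z z] zP by (simp add: V_def P_def inner_diff_left)
  have e1: "(norm (y - proj X J y))\<^sup>2 = (norm a)\<^sup>2 + 2 * (V \<bullet> a) + (norm z)\<^sup>2 - (norm P)\<^sup>2"
  proof -
    have "y - proj X J y = a + (z - P)" unfolding yJ a_def by (simp add: y)
    then show ?thesis unfolding power2_norm_eq_inner
      using za zP aP by (simp add: inner_add_left inner_add_right inner_diff_left inner_diff_right inner_commute)
  qed
  have e2: "(norm (y - proj X S y))\<^sup>2 \<le> (norm z)\<^sup>2"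
    using norm_sq_split[OF subspace_0[OF subspace_col_span], of z X S] unfolding yS by (simp add: y)
  have e3: "(norm (proj X J y - m))\<^sup>2 = (norm a)\<^sup>2 + (norm P)\<^sup>2"
  proof -
    have "proj X J y - m = P - a" unfolding yJ a_def by simp
    then show ?thesis unfolding power2_norm_eq_inner
      using aP by (simp add: inner_diff_left inner_diff_right inner_commute)
  qed
  \<comment> \<open>The factor 2 in the square below is chosen so that half of this inequality
    carries the cross term of \<open>e1\<close>.\<close>
  have e4: "0 \<le> (norm a)\<^sup>2 + 4 * (V \<bullet> a) + 4 * (norm V)\<^sup>2 - 4 * (norm P)\<^sup>2"
  proof -
    have "0 \<le> (norm (a + 2 *\<^sub>R (V - P)))\<^sup>2" by simp
    also have "\<dots> = (norm a)\<^sup>2 + 4 * (V \<bullet> a) + 4 * (norm V)\<^sup>2 - 4 * (norm P)\<^sup>2"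
      unfolding power2_norm_eq_inner using aP VP
      by (simp add: inner_add_left inner_add_right inner_diff_left inner_diff_right inner_commute algebra_simps)
    finally show ?thesis .
  qed
  have "0 \<le> (norm P)\<^sup>2" by simp
  with e1 e2 e3 e4 show ?thesis unfolding V_def[symmetric] by argo
qed

subsection \<open>Gaussian noise\<close>

text \<open>Completing the square: an exponential tilt of a centred normal density is a shift, up to
  a constant.\<close>

lemma normal_density_tilt:
  assumes "\<sigma> > 0"
  shows "normal_density 0 \<sigma> x * exp (a * x) = normal_density 0 \<sigma> (x - \<sigma>\<^sup>2 * a) * exp (\<sigma>\<^sup>2 * a\<^sup>2 / 2)"
proof -
  have "- x\<^sup>2 / (2 * \<sigma>\<^sup>2) + a * x = - (x - \<sigma>\<^sup>2 * a)\<^sup>2 / (2 * \<sigma>\<^sup>2) + \<sigma>\<^sup>2 * a\<^sup>2 / 2"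
    using assms by (simp add: field_simps power2_eq_square)
  then show ?thesis
    unfolding normal_density_def by (simp add: mult.assoc flip: exp_add)
qed

lemma nn_integral_normal_density:
  assumes "\<sigma> > 0"
  shows "(\<integral>\<^sup>+x. ennreal (normal_density \<mu> \<sigma> x) \<partial>lborel) = 1"
  using assms by (subst nn_integral_eq_integral) auto

lemma std_normal_mgf:
  "(\<integral>\<^sup>+g. ennreal (std_normal_density g * exp (a * g)) \<partial>lborel) = ennreal (exp (a\<^sup>2 / 2))"
proof -
  have "std_normal_density g * exp (a * g) = exp (a\<^sup>2 / 2) * normal_density a 1 g" for g
    using normal_density_tilt[of 1 g a] by (simp add: normal_density_def mult_ac)
  then show ?thesis
    by (simp add: ennreal_mult nn_integral_cmult nn_integral_normal_density)
qed

lemma std_normal_sq_mgf: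
  "(\<integral>\<^sup>+g. ennreal (std_normal_density g * exp (g\<^sup>2 / 4)) \<partial>lborel) = ennreal (sqrt 2)"
proof -
  \<comment> \<open>The remaining exponent belongs to variance 2. Its normalization is the
    \<open>sqrt 2\<close> paid per dimension later.\<close>
  have "std_normal_density g * exp (g\<^sup>2 / 4) = sqrt 2 * normal_density 0 (sqrt 2) g" for g
    by (simp add: normal_density_def real_sqrt_mult real_div_sqrt field_simps flip: exp_add)
  then show ?thesis
    by (simp add: ennreal_mult nn_integral_cmult nn_integral_normal_density)
qed

lemma iso_normal_density_nonneg: "0 \<le> iso_normal_density \<sigma> x"
  unfolding iso_normal_density_def by (intro prod_nonneg) auto

lemma iso_normal_density_measurable [measurable]:
  "iso_normal_density \<sigma> \<in> borel_measurable borel"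
  unfolding iso_normal_density_def by measurable

lemma iso_normal_density_tilt:
  assumes "\<sigma> > 0"
  shows "iso_normal_density \<sigma> x * exp (u \<bullet> x)
       = iso_normal_density \<sigma> (x - \<sigma>\<^sup>2 *\<^sub>R u) * exp (\<sigma>\<^sup>2 * (u \<bullet> u) / 2)"
proof -
  have "iso_normal_density \<sigma> x * exp (u \<bullet> x) = (\<Prod>i\<in>UNIV. normal_density 0 \<sigma> (x $ i) * exp (u $ i * x $ i))"
    by (simp add: iso_normal_density_def inner_vec_def exp_sum prod.distrib)
  also have "\<dots> = (\<Prod>i\<in>UNIV. normal_density 0 \<sigma> (x $ i - \<sigma>\<^sup>2 * u $ i) * exp (\<sigma>\<^sup>2 * (u $ i)\<^sup>2 / 2))"
    by (simp add: normal_density_tilt[OF assms])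
  also have "\<dots> = iso_normal_density \<sigma> (x - \<sigma>\<^sup>2 *\<^sub>R u) * exp (\<sigma>\<^sup>2 * (u \<bullet> u) / 2)"
    by (simp add: iso_normal_density_def inner_vec_def prod.distrib power2_eq_square
        sum_distrib_left sum_divide_distrib flip: exp_sum)
  finally show ?thesis .
qed

locale gaussian_noise = prob_space M for M :: "'a measure" +
  fixes \<sigma> :: real and z :: "'a \<Rightarrow> real ^ 'n::finite"
  assumes \<sigma>: "\<sigma> > 0"
    and z: "distributed M lborel z (\<lambda>x. ennreal (iso_normal_density \<sigma> x))"
begin

lemma z_measurable [measurable]: "z \<in> borel_measurable M"
  using distributed_measurable[OF z] by simp

text \<open>The tilt turns the integrand into a multiple of a translate of the density, and
  translation preserves total mass.\<close>

lemma linear_mgf: "(\<integral>\<^sup>+\<omega>. ennreal (exp (u \<bullet> z \<omega>)) \<partial>M) = ennreal (exp (\<sigma>\<^sup>2 * (u \<bullet> u) / 2))"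
proof -
  have 1: "(\<integral>\<^sup>+x. ennreal (iso_normal_density \<sigma> (x :: real ^ 'n)) \<partial>lborel) = 1"
    using distributed_nn_integral[OF z, of "\<lambda>_. 1"] by (simp add: emeasure_space_1)
  have "(\<integral>\<^sup>+\<omega>. ennreal (exp (u \<bullet> z \<omega>)) \<partial>M)
      = (\<integral>\<^sup>+x. ennreal (iso_normal_density \<sigma> x) * ennreal (exp (u \<bullet> x)) \<partial>lborel)"
    by (rule distributed_nn_integral[OF z, symmetric]) measurable
  also have "\<dots> = (\<integral>\<^sup>+x. ennreal (iso_normal_density \<sigma> (x - \<sigma>\<^sup>2 *\<^sub>R u)) * ennreal (exp (\<sigma>\<^sup>2 * (u \<bullet> u) / 2)) \<partial>lborel)"
    by (simp add: iso_normal_density_tilt[OF \<sigma>] iso_normal_density_nonneg flip: ennreal_mult)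
  also have "\<dots> = (\<integral>\<^sup>+x. ennreal (iso_normal_density \<sigma> (x - \<sigma>\<^sup>2 *\<^sub>R u)) \<partial>lborel) * ennreal (exp (\<sigma>\<^sup>2 * (u \<bullet> u) / 2))"
    by (rule nn_integral_multc) measurable
  also have "(\<integral>\<^sup>+x. ennreal (iso_normal_density \<sigma> (x - \<sigma>\<^sup>2 *\<^sub>R u)) \<partial>lborel) = 1"
    unfolding 1[symmetric]
    by (subst (2) lborel_distr_plus[of "- (\<sigma>\<^sup>2 *\<^sub>R u)", symmetric], subst nn_integral_distr) simp_all
  finally show ?thesis by simp
qed

text \<open>Each factor \<open>exp ((b \<bullet> z)\<^sup>2 / (4 * \<sigma>\<^sup>2))\<close> is the average of \<open>exp (g * (b \<bullet> z) / (sqrt 2 * \<sigma>))\<close> over a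
  standard normal \<open>g\<close>. This linearizes the quadratic exponent, so that only
  translation invariance of the Lebesgue measure is needed and no rotation.\<close>

lemma quadratic_mgf:
  assumes "finite B" "pairwise orthogonal B" "\<And>b. b \<in> B \<Longrightarrow> norm b = 1" "\<And>b. b \<in> B \<Longrightarrow> u \<bullet> b = 0"
  shows "(\<integral>\<^sup>+\<omega>. ennreal (exp (u \<bullet> z \<omega> + (\<Sum>b\<in>B. (b \<bullet> z \<omega>)\<^sup>2 / (4 * \<sigma>\<^sup>2)))) \<partial>M)
       = ennreal (sqrt 2 ^ card B * exp (\<sigma>\<^sup>2 * (u \<bullet> u) / 2))"
  using assms
proof (induction B arbitrary: u rule: finite_induct)
  case empty
  then show ?case by (simp add: linear_mgf)
next
  case (insert b B)
  \<comment> \<open>For fixed \<open>g\<close>, the linearized factor of \<open>b\<close> joins the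
    linear term. Since \<open>v g\<close> is still orthogonal to \<open>B\<close>, the induction
    hypothesis, kept general in \<open>u\<close>, applies to it.\<close>
  define v where "v g = u + (g / (sqrt 2 * \<sigma>)) *\<^sub>R b" for g
  define Q where "Q \<omega> = (\<Sum>b\<in>B. (b \<bullet> z \<omega>)\<^sup>2 / (4 * \<sigma>\<^sup>2))" for \<omega>
  have [measurable]: "Q \<in> borel_measurable M" unfolding Q_def by measurable
  have [measurable]: "v \<in> borel_measurable borel" unfolding v_def by measurable
  have bB: "b \<bullet> b' = 0" if "b' \<in> B" for b'
    using insert that by (auto simp: pairwise_insert orthogonal_def)
  have bb: "b \<bullet> b = 1" using insert.prems(2)[of b] by (simp add: norm_eq_1)
  have ub: "u \<bullet> b = 0" "b \<bullet> u = 0" using insert.prems(3)[of b] by (auto simp: inner_commute)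
  have IH: "(\<integral>\<^sup>+\<omega>. ennreal (exp (v g \<bullet> z \<omega> + Q \<omega>)) \<partial>M)
      = ennreal (sqrt 2 ^ card B * exp (\<sigma>\<^sup>2 * (u \<bullet> u) / 2) * exp (g\<^sup>2 / 4))" for g
  proof -
    \<comment> \<open>Cross terms vanish because \<open>u\<close> and \<open>b\<close> are
      orthogonal. The leftover \<open>g\<^sup>2 / 4\<close> is what \<open>std_normal_sq_mgf\<close>
      integrates.\<close>
    have vv: "\<sigma>\<^sup>2 * (v g \<bullet> v g) / 2 = \<sigma>\<^sup>2 * (u \<bullet> u) / 2 + g\<^sup>2 / 4"
      using \<sigma> by (simp add: v_def inner_add_left inner_add_right ub bb field_simps power2_eq_square)
    have "(\<integral>\<^sup>+\<omega>. ennreal (exp (v g \<bullet> z \<omega> + Q \<omega>)) \<partial>M) = ennreal (sqrt 2 ^ card B * exp (\<sigma>\<^sup>2 * (v g \<bullet> v g) / 2))"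
      unfolding Q_def using insert.prems bB
      by (intro insert.IH) (auto simp: pairwise_insert v_def inner_add_left)
    then show ?thesis by (simp only: vv exp_add mult.assoc)
  qed
  have "ennreal (exp (u \<bullet> z \<omega> + (\<Sum>b\<in>insert b B. (b \<bullet> z \<omega>)\<^sup>2 / (4 * \<sigma>\<^sup>2))))
      = (\<integral>\<^sup>+g. ennreal (std_normal_density g) * ennreal (exp (v g \<bullet> z \<omega> + Q \<omega>)) \<partial>lborel)" for \<omega>
  proof -
    \<comment> \<open>Scaled so that \<open>exp (a\<^sup>2 / 2)\<close> is exactly the factor
      contributed by \<open>b\<close>.\<close>
    define a where "a = (b \<bullet> z \<omega>) / (sqrt 2 * \<sigma>)"
    have "(\<Sum>b\<in>insert b B. (b \<bullet> z \<omega>)\<^sup>2 / (4 * \<sigma>\<^sup>2)) = a\<^sup>2 / 2 + Q \<omega>"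
      using insert.hyps by (simp add: a_def Q_def power_divide power_mult_distrib)
    then have "ennreal (exp (u \<bullet> z \<omega> + (\<Sum>b\<in>insert b B. (b \<bullet> z \<omega>)\<^sup>2 / (4 * \<sigma>\<^sup>2))))
        = ennreal (exp (u \<bullet> z \<omega> + Q \<omega>)) * ennreal (exp (a\<^sup>2 / 2))"
      by (simp add: add_ac flip: ennreal_mult exp_add)
    also have "\<dots> = (\<integral>\<^sup>+g. ennreal (exp (u \<bullet> z \<omega> + Q \<omega>)) * ennreal (std_normal_density g * exp (a * g)) \<partial>lborel)"
      unfolding std_normal_mgf[symmetric] by (rule nn_integral_cmult[symmetric]) measurable
    also have "\<dots> = (\<integral>\<^sup>+g. ennreal (std_normal_density g) * ennreal (exp (v g \<bullet> z \<omega> + Q \<omega>)) \<partial>lborel)"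
    proof (intro nn_integral_cong)
      fix g :: real
      have "v g \<bullet> z \<omega> = u \<bullet> z \<omega> + a * g"
        by (simp add: v_def inner_add_left a_def)
      then show "ennreal (exp (u \<bullet> z \<omega> + Q \<omega>)) * ennreal (std_normal_density g * exp (a * g))
          = ennreal (std_normal_density g) * ennreal (exp (v g \<bullet> z \<omega> + Q \<omega>))"
        by (simp add: exp_add mult_ac flip: ennreal_mult)
    qed
    finally show ?thesis .
  qed
  then have "(\<integral>\<^sup>+\<omega>. ennreal (exp (u \<bullet> z \<omega> + (\<Sum>b\<in>insert b B. (b \<bullet> z \<omega>)\<^sup>2 / (4 * \<sigma>\<^sup>2)))) \<partial>M)
      = (\<integral>\<^sup>+\<omega>. \<integral>\<^sup>+g. ennreal (std_normal_density g) * ennreal (exp (v g \<bullet> z \<omega> + Q \<omega>)) \<partial>lborel \<partial>M)"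
    by simp
  also have "\<dots> = (\<integral>\<^sup>+g. \<integral>\<^sup>+\<omega>. ennreal (std_normal_density g) * ennreal (exp (v g \<bullet> z \<omega> + Q \<omega>)) \<partial>M \<partial>lborel)"
  proof -
    interpret P: pair_sigma_finite lborel M
      by (intro pair_sigma_finite.intro sigma_finite_lborel sigma_finite_measure_axioms)
    show ?thesis by (rule P.Fubini') measurable
  qed
  also have "\<dots> = (\<integral>\<^sup>+g. ennreal (std_normal_density g) * (\<integral>\<^sup>+\<omega>. ennreal (exp (v g \<bullet> z \<omega> + Q \<omega>)) \<partial>M) \<partial>lborel)"
    by (intro nn_integral_cong nn_integral_cmult) measurable
  also have "\<dots> = (\<integral>\<^sup>+g. ennreal (sqrt 2 ^ card B * exp (\<sigma>\<^sup>2 * (u \<bullet> u) / 2))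
        * ennreal (std_normal_density g * exp (g\<^sup>2 / 4)) \<partial>lborel)"
    unfolding IH by (simp add: mult_ac flip: ennreal_mult)
  also have "\<dots> = ennreal (sqrt 2 ^ card B * exp (\<sigma>\<^sup>2 * (u \<bullet> u) / 2)) * ennreal (sqrt 2)"
    unfolding std_normal_sq_mgf[symmetric] by (rule nn_integral_cmult) measurable
  also have "\<dots> = ennreal (sqrt 2 ^ card (insert b B) * exp (\<sigma>\<^sup>2 * (u \<bullet> u) / 2))"
    using insert.hyps by (simp add: mult_ac flip: ennreal_mult)
  finally show ?case .
qed

text \<open>In an orthonormal basis the squared norm is a sum of squared coordinates, so
  \<open>quadratic_mgf\<close> applies with \<open>u = 0\<close>. Dependent columns can make the
  dimension smaller than \<open>card K\<close>, hence an inequality.\<close>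

lemma proj_mgf_le:
  "(\<integral>\<^sup>+\<omega>. ennreal (exp ((norm (proj X K (z \<omega>)))\<^sup>2 / (4 * \<sigma>\<^sup>2))) \<partial>M) \<le> ennreal (sqrt 2 ^ card K)"
proof -
  obtain B where B: "B \<subseteq> col_span X K" "pairwise orthogonal B" "\<And>b. b \<in> B \<Longrightarrow> norm b = 1"
      "independent B" "card B = dim (col_span X K)" "span B = col_span X K"
    using orthonormal_basis_subspace[OF subspace_col_span] by metis
  have fin: "finite B" using B(4) by (rule independent_imp_finite)
  have P: "proj X K y = (\<Sum>b\<in>B. (b \<bullet> y) *\<^sub>R b)" for y
  proof (rule proj_unique)
    show "(\<Sum>b\<in>B. (b \<bullet> y) *\<^sub>R b) \<in> col_span X K"
      using B(1) by (intro subspace_sum subspace_scale subspace_col_span) auto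
    have "orthogonal (y - (\<Sum>b\<in>B. (b \<bullet> y / (b \<bullet> b)) *\<^sub>R b)) w" if "w \<in> col_span X K" for w
      using Gram_Schmidt_step[OF B(2), of w y] B(6) that by (simp add: orthogonal_commute)
    moreover have "(b \<bullet> y / (b \<bullet> b)) *\<^sub>R b = (b \<bullet> y) *\<^sub>R b" if "b \<in> B" for b
      using B(3)[OF that] by (simp add: norm_eq_1)
    ultimately show "orthogonal (y - (\<Sum>b\<in>B. (b \<bullet> y) *\<^sub>R b)) w" if "w \<in> col_span X K" for w
      using that by simp
  qed
  have "(norm (proj X K y))\<^sup>2 = (\<Sum>b\<in>B. (b \<bullet> y)\<^sup>2)" for y
  proof -
    have "(norm (\<Sum>b\<in>B. (b \<bullet> y) *\<^sub>R b))\<^sup>2 = (\<Sum>b\<in>B. (norm ((b \<bullet> y) *\<^sub>R b))\<^sup>2)"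
      by (rule norm_sum_Pythagorean[OF fin])
        (use B(2) in \<open>auto simp: pairwise_def orthogonal_def\<close>)
    then show ?thesis using B(3) by (simp add: P)
  qed
  then have "(\<integral>\<^sup>+\<omega>. ennreal (exp ((norm (proj X K (z \<omega>)))\<^sup>2 / (4 * \<sigma>\<^sup>2))) \<partial>M) = ennreal (sqrt 2 ^ card B)"
    using quadratic_mgf[OF fin B(2,3), of 0] by (simp add: sum_divide_distrib)
  also have "\<dots> \<le> ennreal (sqrt 2 ^ card K)"
    using B(5) dim_col_span_le[of X K] by (intro ennreal_leI power_increasing) auto
  finally show ?thesis .
qed

text \<open>Chernoff's argument with the exponential moment of \<open>proj_mgf_le\<close>.\<close>

lemma proj_tail:
  "prob {\<omega> \<in> space M. x * \<sigma>\<^sup>2 < (norm (proj X K (z \<omega>)))\<^sup>2} \<le> sqrt 2 ^ card K * exp (- x / 4)"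
proof -
  let ?A = "{\<omega> \<in> space M. x * \<sigma>\<^sup>2 < (norm (proj X K (z \<omega>)))\<^sup>2}"
  have [measurable]: "?A \<in> sets M" by measurable
  have "emeasure M ?A = (\<integral>\<^sup>+\<omega>. indicator ?A \<omega> \<partial>M)" by simp
  also have "\<dots> \<le> (\<integral>\<^sup>+\<omega>. ennreal (exp (- x / 4)) * ennreal (exp ((norm (proj X K (z \<omega>)))\<^sup>2 / (4 * \<sigma>\<^sup>2))) \<partial>M)"
  proof (intro nn_integral_mono)
    fix \<omega>
    have "1 \<le> exp (- x / 4) * exp ((norm (proj X K (z \<omega>)))\<^sup>2 / (4 * \<sigma>\<^sup>2))" if "\<omega> \<in> ?A"
      using that \<sigma> by (simp add: field_simps flip: exp_add)
    then show "indicator ?A \<omega> \<le> ennreal (exp (- x / 4)) * ennreal (exp ((norm (proj X K (z \<omega>)))\<^sup>2 / (4 * \<sigma>\<^sup>2)))"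
      by (cases "\<omega> \<in> ?A") (simp_all flip: ennreal_mult)
  qed
  also have "\<dots> = ennreal (exp (- x / 4)) * (\<integral>\<^sup>+\<omega>. ennreal (exp ((norm (proj X K (z \<omega>)))\<^sup>2 / (4 * \<sigma>\<^sup>2))) \<partial>M)"
    by (rule nn_integral_cmult) measurable
  also have "\<dots> \<le> ennreal (exp (- x / 4)) * ennreal (sqrt 2 ^ card K)"
    by (intro mult_left_mono proj_mgf_le) simp
  also have "\<dots> = ennreal (sqrt 2 ^ card K * exp (- x / 4))"
    by (simp add: mult.commute flip: ennreal_mult)
  finally show ?thesis
    by (simp add: emeasure_eq_measure)
qed

end

section \<open>Union bound over all sets of columns\<close>

lemma sum_power_card: "(\<Sum>J\<in>UNIV. q ^ card (J :: 'p::finite set)) = (1 + q :: real) ^ CARD('p)"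
  using prod_add[of "UNIV :: 'p set" "\<lambda>_. q" "\<lambda>_. 1"] by (simp add: add.commute)

text \<open>The tails are geometric in \<open>card K\<close>, so \<open>sum_power_card\<close> adds
  them up without counting sets of each size. A quarter of \<open>10 + 4 * c\<close> is
  \<open>5 / 2 + c\<close>: 1 pays for the number of columns, \<open>c\<close> for the confidence
  and \<open>3 / 2\<close> for numerical constants.\<close>

lemma (in gaussian_noise) uniform_proj_bound:
  fixes X :: "real ^ 'p::finite ^ 'n"
  assumes p: "2 \<le> CARD('p)" and c: "c > 0"
  shows "prob {\<omega> \<in> space M. \<forall>K. (norm (proj X K (z \<omega>)))\<^sup>2 \<le> (10 + 4 * c) * ln CARD('p) * card K * \<sigma>\<^sup>2}
       \<ge> 1 - CARD('p) powr (- c)"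
proof -
  let ?p = "real CARD('p)"
  define x where "x K = (10 + 4 * c) * ln ?p * card K" for K :: "'p set"
  define A where "A K = {\<omega> \<in> space M. x K * \<sigma>\<^sup>2 < (norm (proj X K (z \<omega>)))\<^sup>2}" for K
  define q where "q = sqrt 2 * ?p powr (- 5 / 2 - c)"
  have [measurable]: "A K \<in> sets M" for K unfolding A_def by measurable
  have p2: "2 \<le> ?p" using p by simp
  \<comment> \<open>The empty set is kept out of the union bound, where it would contribute
    \<open>q ^ 0 = 1\<close>. Its noise bound is trivial.\<close>
  have proj_empty: "proj X {} y = 0" for y
    using proj_in[of X "{}" y] by (simp add: col_span_def)
  have A: "prob (A K) \<le> q ^ card K" for K
  proof -
    have "exp (- x K / 4) = (?p powr (- 5 / 2 - c)) ^ card K"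
      using p2 by (simp add: x_def powr_def field_simps flip: exp_of_nat_mult)
    then show ?thesis
      using proj_tail[of "x K" X K] by (simp add: A_def q_def power_mult_distrib)
  qed
  have q: "0 \<le> q" "?p * q \<le> ?p powr (- c) / 2"
  proof -
    show "0 \<le> q" by (simp add: q_def)
    have "?p * q = sqrt 2 * ?p powr (- 3 / 2) * ?p powr (- c)"
    proof -
      have "?p * ?p powr (- 5 / 2 - c) = ?p powr (1 + (- 5 / 2 - c))"
        using p2 by (subst powr_add) simp
      also have "\<dots> = ?p powr (- 3 / 2) * ?p powr (- c)"
        by (subst powr_add[symmetric]) simp
      finally show ?thesis by (simp add: q_def)
    qed
    \<comment> \<open>Equality holds for two columns.\<close>
    also have "sqrt 2 * ?p powr (- 3 / 2) \<le> 1 / 2"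
    proof -
      have "?p powr (- 3 / 2) \<le> 2 powr (- 3 / 2)"
        using p2 by (intro powr_mono2') auto
      also have "\<dots> = 2 powr (- 1 / 2) * 2 powr (- 1)"
        by (subst powr_add[symmetric]) simp
      also have "\<dots> = 1 / (2 * sqrt 2)"
        by (simp add: powr_minus powr_half_sqrt field_simps flip: powr_half_sqrt)
      finally have "sqrt 2 * ?p powr (- 3 / 2) \<le> sqrt 2 * (1 / (2 * sqrt 2))"
        by (intro mult_left_mono) auto
      then show ?thesis by simp
    qed
    then have "sqrt 2 * ?p powr (- 3 / 2) * ?p powr (- c) \<le> 1 / 2 * ?p powr (- c)"
      by (intro mult_right_mono) auto
    finally show "?p * q \<le> ?p powr (- c) / 2" by simp
  qed
  have pc: "?p powr (- c) \<le> 1" using p2 c powr_mono[of "- c" 0 ?p] by simp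
  have "prob (\<Union>K\<in>-{{}}. A K) \<le> (\<Sum>K\<in>-{{}}. prob (A K))"
    by (rule measure_UNION_le) auto
  also have "\<dots> \<le> (\<Sum>K\<in>-{{}}. q ^ card (K :: 'p set))"
    by (intro sum_mono A)
  also have "\<dots> = (1 + q) ^ CARD('p) - 1"
    unfolding sum_power_card[symmetric] Compl_eq_Diff_UNIV by (subst sum_diff1) auto
  also have "\<dots> \<le> exp (?p * q) - 1"
  proof -
    have "(1 + q) ^ CARD('p) \<le> exp q ^ CARD('p)"
      using q(1) by (intro power_mono exp_ge_add_one_self) auto
    then show ?thesis by (simp add: exp_of_nat_mult)
  qed
  \<comment> \<open>On the unit interval
    \<open>exp x \<le> 1 + x + x\<^sup>2 \<le> 1 + 2 * x\<close>.\<close>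
  also have "\<dots> \<le> 2 * (?p * q)"
  proof -
    have 1: "0 \<le> ?p * q" "?p * q \<le> 1" using q pc by - (simp, linarith)
    then have "(?p * q) * (?p * q) \<le> (?p * q) * 1" by (intro mult_left_mono)
    then show ?thesis using exp_bound[OF 1] unfolding power2_eq_square by linarith
  qed
  also have "\<dots> \<le> ?p powr (- c)" using q by simp
  finally have *: "prob (\<Union>K\<in>-{{}}. A K) \<le> ?p powr (- c)" .
  have "(norm (proj X {} (z \<omega>)))\<^sup>2 \<le> x {} * \<sigma>\<^sup>2" for \<omega>
    by (simp add: proj_empty x_def)
  then have "(\<forall>K. (norm (proj X K (z \<omega>)))\<^sup>2 \<le> x K * \<sigma>\<^sup>2)
      \<longleftrightarrow> (\<forall>K\<in>-{{}}. (norm (proj X K (z \<omega>)))\<^sup>2 \<le> x K * \<sigma>\<^sup>2)" for \<omega>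
    by (metis ComplI singletonD)
  then have "{\<omega> \<in> space M. \<forall>K. (norm (proj X K (z \<omega>)))\<^sup>2 \<le> x K * \<sigma>\<^sup>2} = space M - (\<Union>K\<in>-{{}}. A K)"
    by (auto simp: A_def simp flip: not_less)
  then show ?thesis
    using * by (simp add: x_def prob_compl)
qed

subsection \<open>The pseudo-posterior\<close>

text \<open>The normalizing constant of the prior is dropped, since it cancels in the
  posterior.\<close>

definition weight :: "real ^ 'p::finite ^ 'n::finite \<Rightarrow> real \<Rightarrow> nat \<Rightarrow> real \<Rightarrow> real ^ 'n \<Rightarrow> 'p set \<Rightarrow> real" where
  "weight X \<sigma> smax lam y J =
     (if card J \<le> smax then inverse (real (CARD('p) choose card J)) * exp (- lam * real (card J)) else 0)
       * exp (- ((norm (y - proj X J y))\<^sup>2) / (2 * \<sigma>\<^sup>2))"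

lemma weight_nonneg: "0 \<le> weight X \<sigma> smax lam y J"
  by (simp add: weight_def)

lemma card_le_CARD: "card (J :: 'p::finite set) \<le> CARD('p)"
  by (rule card_mono) auto

lemma weight_pos: "card J \<le> smax \<Longrightarrow> 0 < weight X \<sigma> smax lam y J"
  by (simp add: weight_def card_le_CARD)

lemma sum_weight_pos: "0 < (\<Sum>J\<in>UNIV. weight X \<sigma> smax lam y J)"
  by (rule sum_pos2[of _ "{}"]) (auto intro: weight_nonneg weight_pos)

lemma posterior_eq:
  "posterior X \<sigma> smax lam y J = weight X \<sigma> smax lam y J / (\<Sum>K\<in>UNIV. weight X \<sigma> smax lam y K)"
proof -
  define v where "v J = (if card J \<le> smax then inverse (real (CARD('a) choose card J)) * exp (- lam * real (card J)) else 0)"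
    for J :: "'a set"
  define V where "V = (\<Sum>J\<in>UNIV. v J)"
  \<comment> \<open>The empty set is admissible for every \<open>smax\<close>.\<close>
  have "0 < V"
    unfolding V_def by (rule sum_pos2[of _ "{}"]) (auto simp: v_def)
  have "prior smax lam J * exp (- ((norm (y - proj X J y))\<^sup>2) / (2 * \<sigma>\<^sup>2)) = weight X \<sigma> smax lam y J / V" for J
    by (simp add: prior_def normalized_def weight_def V_def v_def)
  then show ?thesis
    using \<open>0 < V\<close> by (simp add: posterior_def normalized_def flip: sum_divide_distrib)
qed

lemma posterior_nonneg: "0 \<le> posterior X \<sigma> smax lam y J"
  by (simp add: posterior_eq weight_nonneg sum_nonneg)

lemma posterior_pos: "card J \<le> smax \<Longrightarrow> 0 < posterior X \<sigma> smax lam y J"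
  by (simp add: posterior_eq weight_pos sum_weight_pos)

lemma sum_posterior: "(\<Sum>J\<in>UNIV. posterior X \<sigma> smax lam y J) = 1"
  using sum_weight_pos[of X \<sigma> smax lam y] by (simp add: posterior_eq flip: sum_divide_distrib)

lemma posterior_le_1: "posterior X \<sigma> smax lam y J \<le> 1"
  using member_le_sum[of J UNIV "posterior X \<sigma> smax lam y"]
  by (simp add: posterior_nonneg sum_posterior)

text \<open>The binomial coefficient of \<open>S\<close> costs at most
  \<open>CARD('p) ^ card S\<close>, while that of \<open>J\<close> only lowers the weight. Sets
  larger than \<open>smax\<close> have weight 0 and obey the same estimate.\<close>

lemma weight_ratio:
  fixes X :: "real ^ 'p::finite ^ 'n::finite"
  assumes S: "card S \<le> smax"
  shows "weight X \<sigma> smax lam y J \<le> weight X \<sigma> smax lam y S *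
     exp (real (card S) * ln CARD('p) + lam * (real (card S) - real (card J))
        - ((norm (y - proj X J y))\<^sup>2 - (norm (y - proj X S y))\<^sup>2) / (2 * \<sigma>\<^sup>2))"
proof -
  let ?rss = "\<lambda>J. (norm (y - proj X J y))\<^sup>2 / (2 * \<sigma>\<^sup>2)"
  have chS: "real (CARD('p) choose card S) \<le> exp (real (card S) * ln CARD('p))"
  proof -
    have "real (CARD('p) choose card S) \<le> real (CARD('p) ^ card S)"
      using binomial_le_pow[OF card_le_CARD] of_nat_le_iff by blast
    then show ?thesis by (simp add: exp_of_nat_mult)
  qed
  have chS0: "0 < real (CARD('p) choose card S)"
    by (simp add: card_le_CARD)
  have chJ: "inverse (real (CARD('p) choose card J)) \<le> 1"
  proof -
    have "0 < CARD('p) choose card J" by (simp add: card_le_CARD)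
    then have "1 \<le> real (CARD('p) choose card J)" by linarith
    then show ?thesis by (rule inverse_le_1_iff[THEN iffD2, OF disjI2])
  qed
  have "weight X \<sigma> smax lam y J \<le> exp (- lam * real (card J) - ?rss J)"
  proof -
    have "weight X \<sigma> smax lam y J \<le> 1 * exp (- lam * real (card J)) * exp (- ((norm (y - proj X J y))\<^sup>2) / (2 * \<sigma>\<^sup>2))"
      unfolding weight_def using chJ by (intro mult_right_mono) auto
    then show ?thesis by (simp add: exp_diff exp_minus field_simps)
  qed
  also have "\<dots> = 1 * exp (- lam * real (card J) - ?rss J)" by simp
  also have "\<dots> \<le> (inverse (real (CARD('p) choose card S)) * exp (real (card S) * ln CARD('p)))
       * exp (- lam * real (card J) - ?rss J)"
    using chS chS0 by (intro mult_right_mono) (auto simp: field_simps)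
  also have "\<dots> = inverse (real (CARD('p) choose card S)) * exp (- lam * real (card S)) * exp (- ?rss S) *
     exp (real (card S) * ln CARD('p) + lam * (real (card S) - real (card J)) - (?rss J - ?rss S))"
  proof -
    have "real (card S) * ln CARD('p) + (- lam * real (card J) - ?rss J)
       = - lam * real (card S) + - ?rss S + (real (card S) * ln CARD('p) + lam * (real (card S) - real (card J)) - (?rss J - ?rss S))"
      by (simp add: algebra_simps)
    then show ?thesis by (simp only: mult.assoc exp_add[symmetric])
  qed
  also have "\<dots> = weight X \<sigma> smax lam y S *
     exp (real (card S) * ln CARD('p) + lam * (real (card S) - real (card J)) - (?rss J - ?rss S))"
    using S by (simp add: weight_def)
  finally show ?thesis by (simp add: diff_divide_distrib)
qed

lemma posterior_ratio:
  assumes "card S \<le> smax"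
    and "weight X \<sigma> smax lam y J \<le> weight X \<sigma> smax lam y S * q"
  shows "posterior X \<sigma> smax lam y J \<le> posterior X \<sigma> smax lam y S * q"
  using assms sum_weight_pos[of X \<sigma> smax lam y]
  by (simp add: posterior_eq divide_right_mono)

section \<open>Deterministic risk bounds for a fixed noise vector\<close>

text \<open>Per column, \<open>lam\<close> has to pay for the noise level \<open>b\<close>, for the
  logarithm from the binomial coefficient of \<open>S\<close>, and for a surplus \<open>r\<close>
  that makes posterior ratios summable over all sets.\<close>

locale good_event =
  fixes X :: "real ^ 'p::finite ^ 'n::finite"
    and \<sigma> lam b r :: real and smax :: nat and S :: "'p set" and m z :: "real ^ 'n"
  assumes \<sigma>: "\<sigma> > 0"
    and m: "m \<in> col_span X S"
    and S: "1 \<le> card S" "card S \<le> smax"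
    and noise: "\<And>K. (norm (proj X K z))\<^sup>2 \<le> b * card K * \<sigma>\<^sup>2"
    and b: "0 \<le> b"
    and r: "1 \<le> r" "ln CARD('p) \<le> r"
    and lam: "b + ln CARD('p) + r \<le> lam"
begin

abbreviation "post \<equiv> posterior X \<sigma> smax lam (m + z)"

text \<open>The 8 is 4 times 2: in the log ratio the squared risk has factor \<open>1 / 4\<close>
  and \<open>card S * lam\<close> occurs twice.\<close>

definition excess :: "'p set \<Rightarrow> real" where
  "excess J = (norm (proj X J (m + z) - m))\<^sup>2 / \<sigma>\<^sup>2 - 8 * card S * lam"

lemma lam_ge_1: "1 \<le> lam"
proof -
  have "0 \<le> ln (real CARD('p))" by (simp add: Suc_leI)
  with b r lam show ?thesis by linarith
qed

lemma post_le: "post J \<le> post S * exp (- r * card S - r * card J - excess J / 4)"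
proof (rule posterior_ratio[OF S(2) order_trans[OF weight_ratio[OF S(2)]]], rule mult_left_mono)
  let ?s = "real (card S)" and ?k = "real (card J)" and ?L = "ln (real CARD('p))"
  let ?D = "(norm (m + z - proj X J (m + z)))\<^sup>2 - (norm (m + z - proj X S (m + z)))\<^sup>2"
  define E where "E = (norm (proj X J (m + z) - m))\<^sup>2"
  have L: "0 \<le> ?L" by (simp add: Suc_leI)
  have "(norm (proj X (J \<union> S) z))\<^sup>2 \<le> b * card (J \<union> S) * \<sigma>\<^sup>2" by (rule noise)
  also have "\<dots> \<le> b * (?k + ?s) * \<sigma>\<^sup>2"
    using card_Un_le[of J S] b by (intro mult_right_mono mult_left_mono) (auto simp flip: of_nat_add)
  finally have "?D \<ge> E / 2 - 2 * (b * (?k + ?s) * \<sigma>\<^sup>2)"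
    using risk_decomposition[OF refl m, where J = J and z = z] by (simp add: E_def)
  then have "(E / 2 - 2 * (b * (?k + ?s) * \<sigma>\<^sup>2)) / (2 * \<sigma>\<^sup>2) \<le> ?D / (2 * \<sigma>\<^sup>2)"
    by (intro divide_right_mono) auto
  also have "(E / 2 - 2 * (b * (?k + ?s) * \<sigma>\<^sup>2)) / (2 * \<sigma>\<^sup>2) = E / \<sigma>\<^sup>2 / 4 - b * (?k + ?s)"
    using \<sigma> by (simp add: field_simps)
  finally have D: "E / \<sigma>\<^sup>2 / 4 - b * (?k + ?s) \<le> ?D / (2 * \<sigma>\<^sup>2)" .
  \<comment> \<open>On \<open>S\<close> a second copy of \<open>lam\<close> per column covers noise,
    binomial coefficient and surplus. On \<open>J\<close> the prior penalty itself covers noise and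
    surplus.\<close>
  have "(b + ?L + r) * ?s \<le> lam * ?s" "(b + r) * ?k \<le> lam * ?k"
    by (intro mult_right_mono; use lam L in linarith)+
  with D have "?s * ?L + lam * (?s - ?k) - ?D / (2 * \<sigma>\<^sup>2) \<le> - r * ?s - r * ?k - excess J / 4"
    by (simp add: excess_def E_def[symmetric] algebra_simps diff_divide_distrib)
  then show "exp (?s * ?L + lam * (?s - ?k) - ?D / (2 * \<sigma>\<^sup>2)) \<le> exp (- r * ?s - r * ?k - excess J / 4)"
    by simp
qed (rule weight_nonneg)

lemma map_bound:
  assumes "J \<in> map_models X \<sigma> smax lam (m + z)"
  shows "norm (proj X J (m + z) - m) \<le> \<sigma> * sqrt (8 * card S * lam)"
proof -
  have "post S * 1 \<le> post S * exp (- r * card S - r * card J - excess J / 4)"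
    using assms post_le[of J] by (auto simp: map_models_def is_arg_max_def not_less intro: order_trans)
  then have "0 \<le> - r * card S - r * card J - excess J / 4"
    using posterior_pos[OF S(2), of X \<sigma> lam "m + z"] by simp
  moreover have "0 \<le> r * card S" "0 \<le> r * card J" using r by auto
  ultimately have "excess J \<le> 0" by linarith
  then have "(norm (proj X J (m + z) - m))\<^sup>2 \<le> \<sigma>\<^sup>2 * (8 * card S * lam)"
    using \<sigma> by (simp add: excess_def field_simps)
  then have "norm (proj X J (m + z) - m) \<le> sqrt (\<sigma>\<^sup>2 * (8 * card S * lam))"
    by (rule real_le_rsqrt)
  then show ?thesis using \<sigma> by (simp add: real_sqrt_mult)
qed

text \<open>The bound \<open>x \<le> 4 * exp (x / 4)\<close> cancels the decay of the posterior in
  the excess and leaves a geometric term in \<open>card J\<close>. Its sum over all sets is at most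
  \<open>exp 1\<close> as \<open>CARD('p) * exp (- r) \<le> 1\<close>, and the factor
  \<open>exp (- r)\<close> due to \<open>1 \<le> card S\<close> compensates for that.\<close>

lemma sum_post_excess: "(\<Sum>J\<in>UNIV. post J * excess J) \<le> 4"
proof -
  have "post J * excess J \<le> 4 * exp (- r) * exp (- r) ^ card J" for J
  proof -
    have "excess J \<le> 4 * exp (excess J / 4)"
      using exp_ge_add_one_self[of "excess J / 4"] by linarith
    then have "post J * excess J \<le> post J * (4 * exp (excess J / 4))"
      by (intro mult_left_mono posterior_nonneg)
    also have "\<dots> \<le> (post S * exp (- r * card S - r * card J - excess J / 4)) * (4 * exp (excess J / 4))"
      by (intro mult_right_mono post_le) simp
    also have "\<dots> = post S * (4 * exp (- r * card S - r * card J))"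
      by (simp add: exp_diff)
    also have "\<dots> \<le> 1 * (4 * exp (- r * card S - r * card J))"
      by (intro mult_right_mono posterior_le_1) simp
    also have "\<dots> \<le> 4 * exp (- r - r * card J)"
      using S r by simp
    also have "\<dots> = 4 * exp (- r) * exp (- r) ^ card J"
      by (simp add: exp_diff exp_minus field_simps flip: exp_of_nat_mult)
    finally show ?thesis .
  qed
  then have "(\<Sum>J\<in>UNIV. post J * excess J) \<le> (\<Sum>J\<in>UNIV. 4 * exp (- r) * exp (- r) ^ card (J :: 'p set))"
    by (rule sum_mono)
  also have "\<dots> = 4 * exp (- r) * (1 + exp (- r)) ^ CARD('p)"
    by (simp add: sum_power_card flip: sum_distrib_left)
  also have "\<dots> \<le> 4 * exp (- r) * exp 1"
  proof (intro mult_left_mono)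
    have "(1 + exp (- r)) ^ CARD('p) \<le> exp (exp (- r)) ^ CARD('p)"
      by (intro power_mono exp_ge_add_one_self) (auto intro: add_nonneg_nonneg)
    also have "\<dots> = exp (CARD('p) * exp (- r))" by (simp add: exp_of_nat_mult)
    also have "\<dots> \<le> exp 1"
    proof -
      have "CARD('p) * exp (- r) \<le> CARD('p) * exp (- ln CARD('p))"
        using r by (intro mult_left_mono) auto
      also have "\<dots> = 1" by (simp add: exp_minus)
      finally show ?thesis by simp
    qed
    finally show "(1 + exp (- r)) ^ CARD('p) \<le> exp 1" .
  qed simp
  also have "\<dots> = 4 * exp (1 - r)" by (simp add: exp_diff exp_minus field_simps)
  also have "\<dots> \<le> 4" using r by simp
  finally show ?thesis .
qed

lemma mean_bound:
  "norm ((\<Sum>J\<in>UNIV. post J *\<^sub>R proj X J (m + z)) - m) \<le> \<sigma> * sqrt (12 * card S * lam)"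
proof -
  define a where "a J = norm (proj X J (m + z) - m)" for J
  define A where "A = (\<Sum>J\<in>UNIV. post J * a J)"
  have "m = (\<Sum>J\<in>UNIV. post J *\<^sub>R m)"
    by (simp add: sum_posterior flip: scaleR_sum_left)
  then have "(\<Sum>J\<in>UNIV. post J *\<^sub>R proj X J (m + z)) - m = (\<Sum>J\<in>UNIV. post J *\<^sub>R (proj X J (m + z) - m))"
    by (simp add: scaleR_diff_right sum_subtractf)
  then have "norm ((\<Sum>J\<in>UNIV. post J *\<^sub>R proj X J (m + z)) - m) \<le> (\<Sum>J\<in>UNIV. norm (post J *\<^sub>R (proj X J (m + z) - m)))"
    by (simp only: norm_sum)
  also have "\<dots> = A"
    by (simp add: A_def a_def posterior_nonneg)
  also have "A \<le> sqrt (\<sigma>\<^sup>2 * (12 * card S * lam))"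
  proof (rule real_le_rsqrt)
    \<comment> \<open>Jensen's inequality for the square, as nonnegativity of the posterior variance
      of \<open>a\<close>.\<close>
    have "0 \<le> (\<Sum>J\<in>UNIV. post J * (a J - A)\<^sup>2)"
      by (intro sum_nonneg mult_nonneg_nonneg posterior_nonneg) simp
    also have "\<dots> = (\<Sum>J\<in>UNIV. post J * (a J)\<^sup>2 - 2 * A * (post J * a J) + A\<^sup>2 * post J)"
      by (intro sum.cong refl) (simp add: power2_eq_square algebra_simps)
    also have "\<dots> = (\<Sum>J\<in>UNIV. post J * (a J)\<^sup>2) - 2 * A * A + A\<^sup>2"
      by (simp add: sum.distrib sum_subtractf A_def sum_posterior flip: sum_distrib_left)
    finally have "A\<^sup>2 \<le> (\<Sum>J\<in>UNIV. post J * (a J)\<^sup>2)" by (simp add: power2_eq_square)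
    also have "\<dots> = (\<Sum>J\<in>UNIV. \<sigma>\<^sup>2 * (post J * excess J) + \<sigma>\<^sup>2 * (8 * card S * lam) * post J)"
      using \<sigma> by (intro sum.cong refl) (simp add: a_def excess_def field_simps)
    also have "\<dots> = \<sigma>\<^sup>2 * (\<Sum>J\<in>UNIV. post J * excess J) + \<sigma>\<^sup>2 * (8 * card S * lam)"
      by (simp add: sum.distrib sum_posterior flip: sum_distrib_left)
    also have "\<dots> \<le> \<sigma>\<^sup>2 * 4 + \<sigma>\<^sup>2 * (8 * card S * lam)"
      by (intro add_mono mult_left_mono sum_post_excess) auto
    \<comment> \<open>Here 8 becomes 12: the remainder 4 is absorbed because
      \<open>card S * lam\<close> is at least 1.\<close>
    also have "\<dots> \<le> \<sigma>\<^sup>2 * (12 * card S * lam)"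
    proof -
      have "1 * 1 \<le> card S * lam" using S lam_ge_1 by (intro mult_mono) auto
      then have "4 + 8 * card S * lam \<le> 12 * card S * lam" by (simp add: mult.commute)
      then have "\<sigma>\<^sup>2 * (4 + 8 * card S * lam) \<le> \<sigma>\<^sup>2 * (12 * card S * lam)"
        by (intro mult_left_mono) auto
      then show ?thesis by (simp add: algebra_simps)
    qed
    finally show "A\<^sup>2 \<le> \<sigma>\<^sup>2 * (12 * card S * lam)" .
  qed
  finally show ?thesis using \<sigma> by (simp add: real_sqrt_mult)
qed

end

section \<open>Measurability and conclusion\<close>

lemma posterior_measurable [measurable]:
  "(\<lambda>y. posterior X \<sigma> smax lam y J) \<in> borel_measurable borel"
  unfolding posterior_def normalized_def by measurable

lemma mult_beta_mean:
  "X *v beta_mean X \<sigma> smax lam y = (\<Sum>J\<in>UNIV. posterior X \<sigma> smax lam y J *\<^sub>R proj X J y)"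
  by (simp add: beta_mean_def linear_sum[OF matrix_vector_mul_linear] matrix_vector_mult_scaleR mult_beta_hat)

theorem theorem1:
  fixes M :: "'a measure"
    and X :: "real ^ 'p::finite ^ 'n::finite"
    and \<beta>star :: "real ^ 'p"
    and y z :: "'a \<Rightarrow> real ^ 'n"
    and \<sigma> lam c :: real
    and smax :: nat
  assumes "prob_space M"
    and "CARD('n) \<le> CARD('p)"
    and "\<And>j. norm (column j X) = sqrt (real CARD('n))"
    and "\<sigma> > 0"
    and "distributed M lborel z (\<lambda>x. ennreal (iso_normal_density \<sigma> x))"
    and "\<And>\<omega>. \<omega> \<in> space M \<Longrightarrow> y \<omega> = X *v \<beta>star + z \<omega>"
    and "is_arg_min (\<lambda>\<beta>. card (support \<beta>))
           (\<lambda>\<beta>. X *v \<beta> = prob_space.expectation M y) \<beta>star"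
    and "1 \<le> card (support \<beta>star)"
    and "card (support \<beta>star) \<le> smax"
    and "smax \<le> CARD('p)"
    and "c > 0"
    and "lam = (62 + 12 * c) * ln (real CARD('p))"
  shows "measure M {\<omega> \<in> space M.
           (\<forall>J \<in> map_models X \<sigma> smax lam (y \<omega>).
              norm (X *v beta_hat X (y \<omega>) J - X *v \<beta>star)
                \<le> \<sigma> * sqrt (8 * real (card (support \<beta>star)) * lam)) \<and>
           norm (X *v beta_mean X \<sigma> smax lam (y \<omega>) - X *v \<beta>star)
             \<le> \<sigma> * sqrt (12 * real (card (support \<beta>star)) * lam)}
         \<ge> 1 - real CARD('p) powr (- c)"
    (is "measure M ?G \<ge> _")
\<comment> \<open>With a single column the claimed probability bound is 0. The union bound needs at
  least two.\<close>
proof (cases "CARD('p) = 1")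
  case True
  then show ?thesis by simp
next
  case False
  then have p: "2 \<le> CARD('p)"
    by (metis One_nat_def Suc_leI le_antisym not_less_eq_eq numeral_2_eq_2 zero_less_card_finite)
  interpret gaussian_noise M \<sigma> z
    using assms by (intro gaussian_noise.intro gaussian_noise_axioms.intro)
  let ?L = "ln (real CARD('p))"
  let ?m = "X *v \<beta>star"
  let ?N = "{\<omega> \<in> space M. \<forall>K. (norm (proj X K (z \<omega>)))\<^sup>2 \<le> (10 + 4 * c) * ?L * card K * \<sigma>\<^sup>2}"
  \<comment> \<open>A lower bound on \<open>?L\<close> is needed for the surplus
    \<open>51 * ?L\<close> to be at least 1.\<close>
  have "ln 2 \<le> ?L" using p by simp
  then have L: "2 / 3 \<le> ?L" using ln2_ge_two_thirds by linarith
  have "?N \<subseteq> ?G"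
  proof
    fix \<omega> assume \<omega>: "\<omega> \<in> ?N"
    have cL: "0 \<le> c * ?L" using L \<open>c > 0\<close> by simp
    \<comment> \<open>The budget closes because \<open>10 + 1 + 51 = 62\<close> and
      \<open>12 * c\<close> exceeds \<open>4 * c\<close>.\<close>
    interpret good_event X \<sigma> lam "(10 + 4 * c) * ?L" "51 * ?L" smax "support \<beta>star" ?m "z \<omega>"
      using assms(4,8,9) \<omega> L cL by unfold_locales (auto simp: mult_in_col_span assms(12) algebra_simps)
    show "\<omega> \<in> ?G"
      using \<omega> map_bound mean_bound by (simp add: assms(6) mult_beta_hat mult_beta_mean)
  qed
  \<comment> \<open>The set of maximizers varies with the outcome, so the quantifier over it is
    unfolded into quantifiers over the finitely many sets, and the estimators are replaced by
    measurable projections.\<close>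
  moreover have "?G \<in> sets M"
  proof -
    have "?G = {\<omega> \<in> space M.
           (\<forall>J. (\<forall>K. \<not> posterior X \<sigma> smax lam (?m + z \<omega>) J < posterior X \<sigma> smax lam (?m + z \<omega>) K) \<longrightarrow>
              norm (proj X J (?m + z \<omega>) - ?m) \<le> \<sigma> * sqrt (8 * real (card (support \<beta>star)) * lam)) \<and>
           norm ((\<Sum>J\<in>UNIV. posterior X \<sigma> smax lam (?m + z \<omega>) J *\<^sub>R proj X J (?m + z \<omega>)) - ?m)
             \<le> \<sigma> * sqrt (12 * real (card (support \<beta>star)) * lam)}"
      by (auto simp: assms(6) mult_beta_hat mult_beta_mean map_models_def is_arg_max_def)
    also have "\<dots> \<in> sets M" by measurable
    finally show ?thesis .
  qed
  ultimately have "prob ?N \<le> prob ?G" by (intro finite_measure_mono)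
  with uniform_proj_bound[OF p \<open>c > 0\<close>, of X] show ?thesis by simp
qed

end
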